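(* Let $K/k$ be a purely inseparable extension. The following assertions are equivalent: (1) For every intermediate field $L$ of $K/k$, $K/L$ is $lq$-finite. (2) For every intermediate field $L$ of $K/k$, the extension $L/k(L^p)$ is finite. (3) For every intermediate field $L$ of $K/k$, the extension $L/rp(L/k)$ is finite.
   Context: All fields are commutative of characteristic $p>0$. A purely inseparable extension $K/L$ is $lq$-finite if for every $n\ge 1$ the field $L^{p^{-n}}\cap K=\{x\in K:x^{p^n}\in L\}$ is a finite extension of $L$. An extension $M/k$ is relatively perfect if $k(M^p)=M$; every extension $L/k$ has a largest relatively perfect subextension, denoted $rp(L/k)$ (the relatively perfect closure of $L/k$). *)

theory Defs
  imports "HOL-Algebra.Algebra"
begin

text \<open>
  Field extensions are treated inside one ambient field \<open>R\<close>: its subfields are sets \<open>k\<close>, \<open>L\<close>, \<open>M\<close>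
  with \<open>subfield k R\<close>, and finiteness of \<open>E/F\<close> is \<open>ring.finite_dimension R F E\<close>.
\<close>

text \<open>The additive order of \<open>\<one>\<close>; \<open>group.ord\<close> is \<open>0\<close> for elements of infinite order.\<close>

definition characteristic :: "('a, 'b) ring_scheme \<Rightarrow> nat" where
  "characteristic R = group.ord (add_monoid R) \<one>\<^bsub>R\<^esub>"

definition intermediate_field :: "('a, 'b) ring_scheme \<Rightarrow> 'a set \<Rightarrow> 'a set \<Rightarrow> 'a set \<Rightarrow> bool" where
  "intermediate_field R k E L \<longleftrightarrow> subfield L R \<and> k \<subseteq> L \<and> L \<subseteq> E"

definition purely_inseparable :: "('a, 'b) ring_scheme \<Rightarrow> 'a set \<Rightarrow> 'a set \<Rightarrow> bool" where
  "purely_inseparable R k E \<longleftrightarrow>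
     subfield k R \<and> subfield E R \<and> k \<subseteq> E \<and>
     (\<forall>x\<in>E. \<exists>n::nat. x [^]\<^bsub>R\<^esub> (characteristic R ^ n) \<in> k)"

text \<open>\<open>root_field R L n E\<close> is \<open>L\<^bsup>p\<^sup>-\<^sup>n\<^esup> \<inter> E\<close>, where \<open>p\<close> is the characteristic.\<close>

definition root_field :: "('a, 'b) ring_scheme \<Rightarrow> 'a set \<Rightarrow> nat \<Rightarrow> 'a set \<Rightarrow> 'a set" where
  "root_field R L n E = {x \<in> E. x [^]\<^bsub>R\<^esub> (characteristic R ^ n) \<in> L}"

definition lq_finite :: "('a, 'b) ring_scheme \<Rightarrow> 'a set \<Rightarrow> 'a set \<Rightarrow> bool" where
  "lq_finite R L E \<longleftrightarrow> (\<forall>n\<ge>1. ring.finite_dimension R L (root_field R L n E))"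

text \<open>\<open>adjoin_pth_powers R k M\<close> is the field \<open>k(M\<^sup>p)\<close>.\<close>

definition adjoin_pth_powers :: "('a, 'b) ring_scheme \<Rightarrow> 'a set \<Rightarrow> 'a set \<Rightarrow> 'a set" where
  "adjoin_pth_powers R k M = generate_field R (k \<union> (\<lambda>x. x [^]\<^bsub>R\<^esub> characteristic R) ` M)"

definition relatively_perfect :: "('a, 'b) ring_scheme \<Rightarrow> 'a set \<Rightarrow> 'a set \<Rightarrow> bool" where
  "relatively_perfect R k M \<longleftrightarrow> adjoin_pth_powers R k M = M"

definition rp :: "('a, 'b) ring_scheme \<Rightarrow> 'a set \<Rightarrow> 'a set \<Rightarrow> 'a set" where
  "rp R k L = (GREATEST M. intermediate_field R k L M \<and> relatively_perfect R k M)"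

text \<open>The greatest element in the definition of \<open>rp\<close> exists.\<close>

lemma rp_greatest:
  assumes R: "field R" and k: "subfield k R" and L: "subfield L R" and kL: "k \<subseteq> L"
  shows rp_intermediate: "intermediate_field R k L (rp R k L)"
    and rp_relatively_perfect: "relatively_perfect R k (rp R k L)"
    and rp_upper: "\<And>M. \<lbrakk>intermediate_field R k L M; relatively_perfect R k M\<rbrakk> \<Longrightarrow> M \<subseteq> rp R k L"
proof -
  interpret field R by fact
  let ?P = "\<lambda>M. intermediate_field R k L M \<and> relatively_perfect R k M"
  let ?f = "\<lambda>x. x [^]\<^bsub>R\<^esub> characteristic R"
  define U where "U = generate_field R (\<Union> {M. ?P M})"
  have sc: "M \<subseteq> carrier R" if "subfield M R" for M
    using that by (rule subfieldE(3))
  have pw: "?f ` M \<subseteq> M" if "subfield M R" for M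
  proof -
    have "x [^]\<^bsub>R\<^esub> (n::nat) \<in> M" if "x \<in> M" for x n
      using that subringE(3,6)[OF subfieldE(1)[OF \<open>subfield M R\<close>]]
      by (induction n) auto
    then show ?thesis by blast
  qed
  have gen_le: "generate_field R H \<subseteq> M" if "subfield M R" "H \<subseteq> M" for H M
    using generate_field_min_subfield1[of H M] that sc[of M] by blast
  have gen_sub: "subfield (generate_field R H) R" if "H \<subseteq> carrier R" for H
    using generate_field_is_subfield that by blast
  have inL: "\<Union> {M. ?P M} \<subseteq> L"
    by (auto simp: intermediate_field_def)
  have Usub: "subfield U R"
    unfolding U_def using inL sc[OF L] by (intro gen_sub) blast
  have UL: "U \<subseteq> L"
    unfolding U_def using inL by (rule gen_le[OF L])
  have upper: "M \<subseteq> U" if "?P M" for M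
    using that unfolding U_def by (blast intro: generate_field.incl)
  have "?P k"
    using k kL gen_le[OF k, of "k \<union> ?f ` k"] pw[OF k]
    unfolding intermediate_field_def relatively_perfect_def adjoin_pth_powers_def
    by (auto intro: generate_field.incl)
  then have kU: "k \<subseteq> U" by (rule upper)
  have le: "adjoin_pth_powers R k U \<subseteq> U"
    unfolding adjoin_pth_powers_def using kU pw[OF Usub] by (intro gen_le[OF Usub]) blast
  have sub: "subfield (adjoin_pth_powers R k U) R"
    unfolding adjoin_pth_powers_def using kU pw[OF Usub] sc[OF Usub] by (intro gen_sub) blast
  have "M \<subseteq> adjoin_pth_powers R k U" if "?P M" for M
  proof -
    have "k \<union> ?f ` M \<subseteq> adjoin_pth_powers R k U"
      using upper[OF that] unfolding adjoin_pth_powers_def by (blast intro: generate_field.incl)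
    then have "adjoin_pth_powers R k M \<subseteq> adjoin_pth_powers R k U"
      unfolding adjoin_pth_powers_def[of R k M] by (rule gen_le[OF sub])
    then show ?thesis using that by (simp add: relatively_perfect_def)
  qed
  then have ge: "U \<subseteq> adjoin_pth_powers R k U"
    unfolding U_def[symmetric] by (subst (1) U_def, intro gen_le[OF sub]) blast
  have PU: "?P U"
    using Usub kU UL le ge by (auto simp: intermediate_field_def relatively_perfect_def)
  have "rp R k L = U"
    unfolding rp_def using PU upper by (intro Greatest_equality) auto
  with PU upper show "intermediate_field R k L (rp R k L)" "relatively_perfect R k (rp R k L)"
    "\<And>M. \<lbrakk>intermediate_field R k L M; relatively_perfect R k M\<rbrakk> \<Longrightarrow> M \<subseteq> rp R k L"
    by auto
qed

end

theory Submission
  imports Defs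
begin

text \<open>
  Write \<open>P M = k(M\<^sup>p)\<close>. Condition (2) says that \<open>M\<close> is finite over \<open>P M\<close> for every intermediate
  field \<open>M\<close>, and it is compared with each of the other two conditions.

  (1) and (2). Every element of \<open>L\<close> has its \<open>p\<close>-th power in \<open>P L\<close>, so \<open>L\<close> lies in the first root
  field of \<open>P L\<close> in \<open>K\<close>, and \<open>lq\<close>-finiteness of \<open>K/P L\<close> makes \<open>L/P L\<close> finite. Conversely, let
  \<open>M\<^sub>n\<close> be the \<open>n\<close>-th root field of \<open>L\<close> in \<open>K\<close>. Taking \<open>p\<close>-th powers maps \<open>M\<^sub>n\<^sub>+\<^sub>1\<close> into \<open>M\<^sub>n\<close>, so
  \<open>P M\<^sub>n\<^sub>+\<^sub>1 \<subseteq> M\<^sub>n \<subseteq> M\<^sub>n\<^sub>+\<^sub>1\<close>; by (2) each step of the tower \<open>L = M\<^sub>0 \<subseteq> M\<^sub>1 \<subseteq> \<dots>\<close> is finite. That the root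
  fields are fields rests on the additivity of the Frobenius map.

  (2) implies (3). Let \<open>L\<close> be generated over \<open>P L\<close> by a finite set \<open>A\<close>. The Frobenius map carries this
  generation down the chain \<open>L \<supseteq> P L \<supseteq> P (P L) \<supseteq> \<dots>\<close>: the \<open>n\<close>-th term is generated over the next
  one by the \<open>p\<^sup>n\<close>-th powers of \<open>A\<close> (\<open>iterated_adjoin_pth_powers_generators\<close>). Because \<open>A\<close> is finite
  and \<open>K/k\<close> is purely inseparable, some \<open>n\<close> puts all these powers into \<open>k\<close>. At that point the
  chain becomes stationary, which means that its \<open>n\<close>-th term is relatively perfect over \<open>k\<close>
  (\<open>iterated_adjoin_pth_powers_relatively_perfect\<close>) and hence contained in \<open>rp(L/k)\<close>. By (2) every
  step of the chain is finite, so \<open>L\<close> is finite over this term and, a fortiori, over \<open>rp(L/k)\<close>.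

  (3) implies (2). Relative perfectness of \<open>M\<close> means \<open>M = P M\<close>; for \<open>M = rp(L/k) \<subseteq> L\<close> this gives
  \<open>rp(L/k) \<subseteq> P L \<subseteq> L\<close>, and finiteness passes to the larger base \<open>P L\<close>.
\<close>

section \<open>The binomial theorem\<close>

text \<open>
  Induction with Pascal's rule. Let \<open>S\<close> be the expansion of the \<open>n\<close>-th power. In the coefficient of
  index \<open>Suc i\<close> for \<open>Suc n\<close>, the summand \<open>n choose i\<close> comes from \<open>S \<otimes> a\<close>, where the multiplication
  by \<open>a\<close> shifts the exponent, and the summand \<open>n choose Suc i\<close> comes from \<open>S \<otimes> b\<close>, whose sum is
  reindexed after splitting off its term of index \<open>0\<close>.
\<close>
lemma (in cring) binomial_expansion:
  assumes a: "a \<in> carrier R" and b: "b \<in> carrier R"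
  shows "(a \<oplus> b) [^] n = (\<Oplus>i\<in>{..n}. add_pow R (n choose i) (a [^] i \<otimes> b [^] (n - i)))"
proof (induction n)
  case 0
  show ?case using a b by simp
next
  case (Suc n)
  define t where "t j i m = add_pow R (j choose i) (a [^] (i::nat) \<otimes> b [^] (m::nat))" for j i m :: nat
  have tc [simp, intro]: "t j i m \<in> carrier R" for j i m
    using a b by (simp add: t_def)
  define S where "S = (\<Oplus>i\<in>{..n}. t n i (n - i))"
  have Sc [simp, intro]: "S \<in> carrier R"
    unfolding S_def by (intro finsum_closed) auto
  have "S \<otimes> a = (\<Oplus>i\<in>{..n}. t n i (n - i) \<otimes> a)"
    unfolding S_def using a by (intro finsum_ldistr) auto
  also have "\<dots> = (\<Oplus>i\<in>{..n}. add_pow R (n choose i) (a [^] Suc i \<otimes> b [^] (n - i)))"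
  proof (intro finsum_cong')
    fix i
    have "t n i (n - i) \<otimes> a = add_pow R (n choose i) ((a [^] i \<otimes> b [^] (n - i)) \<otimes> a)"
      unfolding t_def using a b by (intro add_pow_ldistr) auto
    then show "t n i (n - i) \<otimes> a = add_pow R (n choose i) (a [^] Suc i \<otimes> b [^] (n - i))"
      using a b by (simp add: m_ac)
  qed (use a b in auto)
  finally have aS: "S \<otimes> a = (\<Oplus>i\<in>{..n}. add_pow R (n choose i) (a [^] Suc i \<otimes> b [^] (n - i)))" .
  have "S \<otimes> b = (\<Oplus>i\<in>{..n}. t n i (n - i) \<otimes> b)"
    unfolding S_def using b by (intro finsum_ldistr) auto
  also have "\<dots> = (\<Oplus>i\<in>{..n}. t n i (Suc n - i))"
    using a b by (intro finsum_cong') (auto simp: t_def add_pow_ldistr m_assoc Suc_diff_le)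
  \<comment> \<open>A term with binomial coefficient zero extends the sum to the index \<open>Suc n\<close>.\<close>
  also have "\<dots> = t n (Suc n) 0 \<oplus> (\<Oplus>i\<in>{..n}. t n i (Suc n - i))"
  proof -
    have "t n (Suc n) 0 = \<zero>"
      using a b by (simp add: t_def binomial_eq_0)
    moreover have "(\<Oplus>i\<in>{..n}. t n i (Suc n - i)) \<in> carrier R"
      by (intro finsum_closed) auto
    ultimately show ?thesis
      by simp
  qed
  also have "\<dots> = (\<Oplus>i\<in>{..Suc n}. t n i (Suc n - i))"
    by (subst finsum_Suc) auto
  also have "\<dots> = (\<Oplus>i\<in>{..n}. t n (Suc i) (n - i)) \<oplus> t n 0 (Suc n)"
    by (subst finsum_Suc2) auto
  finally have bS: "S \<otimes> b = (\<Oplus>i\<in>{..n}. t n (Suc i) (n - i)) \<oplus> t n 0 (Suc n)" .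
  have "(\<Oplus>i\<in>{..Suc n}. t (Suc n) i (Suc n - i))
      = (\<Oplus>i\<in>{..n}. t (Suc n) (Suc i) (n - i)) \<oplus> t (Suc n) 0 (Suc n)"
    by (subst finsum_Suc2) auto
  also have "(\<Oplus>i\<in>{..n}. t (Suc n) (Suc i) (n - i))
      = (\<Oplus>i\<in>{..n}. add_pow R (n choose i) (a [^] Suc i \<otimes> b [^] (n - i)) \<oplus> t n (Suc i) (n - i))"
  proof (intro finsum_cong')
    fix i
    show "t (Suc n) (Suc i) (n - i)
        = add_pow R (n choose i) (a [^] Suc i \<otimes> b [^] (n - i)) \<oplus> t n (Suc i) (n - i)"
      unfolding t_def using a b by (simp add: add.nat_pow_mult)
  qed (use a b in auto)
  also have "\<dots> = S \<otimes> a \<oplus> (\<Oplus>i\<in>{..n}. t n (Suc i) (n - i))"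
    unfolding aS using a b by (intro finsum_addf) auto
  also have "\<dots> \<oplus> t (Suc n) 0 (Suc n) = S \<otimes> a \<oplus> S \<otimes> b"
  proof -
    have "(\<Oplus>i\<in>{..n}. t n (Suc i) (n - i)) \<in> carrier R"
      by (intro finsum_closed) auto
    moreover have "t (Suc n) 0 (Suc n) = t n 0 (Suc n)"
      by (simp add: t_def)
    ultimately show ?thesis
      unfolding bS using a by (simp add: a_assoc)
  qed
  also have "\<dots> = S \<otimes> (a \<oplus> b)"
    using a b by (simp add: r_distr)
  also have "\<dots> = (a \<oplus> b) [^] Suc n"
    unfolding S_def t_def using Suc by simp
  finally show ?case by (simp add: t_def)
qed

section \<open>Finite extensions inside an ambient field\<close>

lemma (in ring) subfield_is_subalgebra:
  assumes "subfield E R" "F \<subseteq> E"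
  shows "subalgebra F E R"
proof -
  note sub = subfieldE(1)[OF assms(1)]
  show ?thesis
    using subring.axioms(1)[OF sub] subringE(6)[OF sub] assms(2)
    by (auto simp: subalgebra_def subalgebra_axioms_def)
qed

lemma (in ring) finite_dimension_spanE:
  assumes "subfield F R" "finite_dimension F E"
  obtains Us where "set Us \<subseteq> E" "Span F Us = E"
proof -
  obtain n where "dimension n F E"
    using assms(2) by blast
  then obtain Us where "set Us \<subseteq> carrier R" "Span F Us = E"
    using exists_base[OF assms(1)] by blast
  then show thesis
    using that Span_base_incl[OF assms(1)] by blast
qed

text \<open>
  A finite spanning set over \<open>F\<close> still spans over a larger field of scalars.
\<close>
lemma (in ring) finite_dimension_over_larger_field:
  assumes F: "subfield F R" and F': "subfield F' R" and "F \<subseteq> F'"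
    and E: "subalgebra F' E R" and fin: "finite_dimension F E"
  shows "finite_dimension F' E"
proof -
  obtain Us where Us: "set Us \<subseteq> E" "Span F Us = E"
    using finite_dimension_spanE[OF F fin] .
  then have c: "set Us \<subseteq> carrier R"
    using subalgebra_in_carrier[OF E] by blast
  have "subalgebra F (Span F' Us) R"
    using Span_is_subalgebra[OF F' c] \<open>F \<subseteq> F'\<close>
    by (auto simp: subalgebra_def subalgebra_axioms_def)
  then have "E \<subseteq> Span F' Us"
    using subalgebra_Span_incl[OF F _ Span_base_incl[OF F' c]] Us(2) by blast
  moreover have "Span F' Us \<subseteq> E"
    by (rule subalgebra_Span_incl[OF F' E Us(1)])
  ultimately show ?thesis
    using Span_finite_dimension[OF F' c] by simp
qed

lemma (in ring) finite_dimension_of_intermediate_field: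
  assumes F: "subfield F R" and M: "subfield M R" and E: "subfield E R"
    and "F \<subseteq> M" "M \<subseteq> E" and fin: "finite_dimension F E"
  shows "finite_dimension M E" "finite_dimension F M"
  using finite_dimension_over_larger_field[OF F M \<open>F \<subseteq> M\<close> _ fin]
    subalbegra_incl_imp_finite_dimension[OF F fin _ \<open>M \<subseteq> E\<close>]
    subfield_is_subalgebra[OF E \<open>M \<subseteq> E\<close>] subfield_is_subalgebra[OF M \<open>F \<subseteq> M\<close>]
  by blast+

lemma (in field) finite_dimension_imp_finitely_generated:
  assumes F: "subfield F R" and E: "subfield E R" and "F \<subseteq> E" and fin: "finite_dimension F E"
  obtains A where "finite A" "A \<subseteq> E" "generate_field R (F \<union> A) = E"
proof -
  obtain Us where Us: "set Us \<subseteq> E" "Span F Us = E"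
    using finite_dimension_spanE[OF F fin] .
  define G where "G = generate_field R (F \<union> set Us)"
  have c: "F \<union> set Us \<subseteq> carrier R"
    using Us(1) \<open>F \<subseteq> E\<close> subfieldE(3)[OF E] by blast
  have incl: "F \<union> set Us \<subseteq> G"
    unfolding G_def by (blast intro: generate_field.incl)
  have "subfield G R"
    unfolding G_def by (rule generate_field_is_subfield[OF c])
  then have "E \<subseteq> G"
    using subalgebra_Span_incl[OF F subfield_is_subalgebra] incl Us(2) by blast
  moreover have "G \<subseteq> E"
    unfolding G_def using Us(1) \<open>F \<subseteq> E\<close> by (intro generate_field_min_subfield1[OF c E]) blast
  ultimately show thesis
    using that[of "set Us"] Us(1) unfolding G_def by blast
qed

section \<open>The Frobenius map\<close>

locale positive_characteristic_field = field +
  assumes characteristic_pos: "characteristic R > 0"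
begin

abbreviation p :: nat where "p \<equiv> characteristic R"

lemma add_pow_one_eq_zero_iff: "add_pow R (n::nat) \<one> = \<zero> \<longleftrightarrow> p dvd n"
  using add.pow_eq_id[OF one_closed, of n] by (simp add: characteristic_def add_pow_def)

text \<open>
  The absence of zero divisors, applied to the multiples of \<open>\<one>\<close>, is exactly the primality of
  the generator of the ideal of integers that annihilate \<open>\<one>\<close>.
\<close>
lemma prime_characteristic: "Factorial_Ring.prime p"
proof -
  have "add_pow R (1::nat) \<one> \<noteq> \<zero>"
    by simp
  then have "p \<noteq> 1"
    using add_pow_one_eq_zero_iff[of 1] by auto
  moreover have "p dvd m \<or> p dvd n" if "p dvd m * n" for m n
  proof -
    have "add_pow R m \<one> \<otimes> add_pow R n \<one> = add_pow R (m * n) \<one>"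
      by (simp add: add_pow_ldistr add.nat_pow_pow mult.commute)
    then have "add_pow R m \<one> \<otimes> add_pow R n \<one> = \<zero>"
      using that by (simp add: add_pow_one_eq_zero_iff)
    then show ?thesis
      using integral[of "add_pow R m \<one>" "add_pow R n \<one>"]
      by (simp add: add_pow_one_eq_zero_iff)
  qed
  ultimately show ?thesis
    using characteristic_pos unfolding Factorial_Ring.prime_def prime_elem_def by auto
qed

lemma add_pow_eq_zero:
  assumes "p dvd n" "x \<in> carrier R"
  shows "add_pow R n x = \<zero>"
proof -
  have "add_pow R n x = add_pow R n \<one> \<otimes> x"
    using assms by (simp add: add_pow_ldistr)
  also have "add_pow R n \<one> = \<zero>"
    using assms by (simp add: add_pow_one_eq_zero_iff)
  finally show ?thesis using assms by simp
qed

text \<open>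
  Every binomial coefficient strictly inside the row of the prime \<open>p\<close> is divisible by \<open>p\<close>, so only the
  two outer terms of the expansion survive.
\<close>
lemma frobenius_add:
  assumes a: "a \<in> carrier R" and b: "b \<in> carrier R"
  shows "(a \<oplus> b) [^] p = a [^] p \<oplus> b [^] p"
proof -
  define t where "t i = add_pow R (p choose i) (a [^] i \<otimes> b [^] (p - i))" for i :: nat
  have t: "t i \<in> carrier R" for i
    using a b by (simp add: t_def)
  obtain m where m: "p = Suc m"
    using characteristic_pos by (cases p) auto
  have "t i = (if 0 = i then t i else \<zero>)" if "i \<le> m" for i
  proof (cases "i = 0")
    case False
    then have "p dvd (p choose i)"
      using that m by (intro dvd_choose_prime prime_characteristic) auto
    then show ?thesis
      using False a b by (simp add: t_def add_pow_eq_zero)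
  qed simp
  then have "finsum R t {..m} = (\<Oplus>i\<in>{..m}. if 0 = i then t i else \<zero>)"
    using t by (intro finsum_cong') auto
  also have "\<dots> = t 0"
    using t by (intro add.finprod_singleton) auto
  finally have low: "finsum R t {..m} = t 0" .
  have "(a \<oplus> b) [^] p = finsum R t {..p}"
    unfolding t_def by (rule binomial_expansion[OF a b])
  also have "\<dots> = t p \<oplus> finsum R t {..m}"
    unfolding m using t by (intro finsum_Suc) auto
  also have "\<dots> = a [^] p \<oplus> b [^] p"
    unfolding low using a b by (simp add: t_def)
  finally show ?thesis .
qed

lemma frobenius_power_add:
  assumes "a \<in> carrier R" "b \<in> carrier R"
  shows "(a \<oplus> b) [^] (p ^ n) = a [^] (p ^ n) \<oplus> b [^] (p ^ n)"
proof (induction n)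
  case (Suc n)
  have "x [^] (p ^ Suc n) = (x [^] (p ^ n)) [^] p" if "x \<in> carrier R" for x
    using that by (simp add: nat_pow_pow mult.commute)
  then show ?case
    using Suc assms by (simp add: frobenius_add)
qed (use assms in simp)

lemma subfield_nat_pow_closed:
  assumes "subfield L R" "x \<in> L"
  shows "x [^] (n::nat) \<in> L"
  using assms(2) subringE(3,6)[OF subfieldE(1)[OF assms(1)]] by (induction n) auto

text \<open>
  A root field is the intersection of \<open>E\<close> with the preimage of \<open>L\<close> under an iterate of the Frobenius
  map, which is a ring homomorphism.
\<close>
lemma root_field_is_subfield:
  assumes L: "subfield L R" and E: "subfield E R"
  shows "subfield (root_field R L n E) R"
proof -
  note subs = subringE[OF subfieldE(1)[OF L]] subringE[OF subfieldE(1)[OF E]]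
  have Ec: "x \<in> carrier R" if "x \<in> E" for x
    using subfieldE(3)[OF E] that by blast
  have mult: "x \<otimes> y \<in> root_field R L n E" if "x \<in> root_field R L n E" "y \<in> root_field R L n E" for x y
    using that subs(6,13) by (auto simp: root_field_def pow_mult_distrib[OF m_comm] Ec)
  show ?thesis
  proof (rule subfieldI')
    show "subring (root_field R L n E) R"
    proof (rule subringI)
      show "root_field R L n E \<subseteq> carrier R"
        using Ec by (auto simp: root_field_def)
      show "\<one> \<in> root_field R L n E"
        using subs by (auto simp: root_field_def)
      fix x assume x: "x \<in> root_field R L n E"
      \<comment> \<open>\<open>L\<close> contains every power of \<open>\<ominus> \<one>\<close>, whatever the parity of the exponent.\<close>
      have "\<ominus> \<one> \<in> root_field R L n E"
        using subs subfield_nat_pow_closed[OF L] by (auto simp: root_field_def)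
      then show "\<ominus> x \<in> root_field R L n E"
        using mult[OF _ x] x Ec by (fastforce simp: root_field_def l_minus)
    next
      fix x y assume "x \<in> root_field R L n E" "y \<in> root_field R L n E"
      then show "x \<oplus> y \<in> root_field R L n E"
        using subs by (auto simp: root_field_def frobenius_power_add Ec)
    qed (rule mult)
  next
    fix x assume x: "x \<in> root_field R L n E - {\<zero>}"
    then have xU: "x \<in> Units R" using Ec by (auto simp: root_field_def field_Units)
    have nz: "x [^] (p ^ n) \<noteq> \<zero>"
      using Units_pow_closed[OF xU, of "p ^ n"] by (auto simp: field_Units)
    have "inv x [^] (p ^ n) = inv (x [^] (p ^ n))"
    proof (rule comm_inv_char[symmetric])
      have "x [^] (p ^ n) \<otimes> inv x [^] (p ^ n) = (x \<otimes> inv x) [^] (p ^ n)"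
        using xU by (intro pow_mult_distrib[symmetric] m_comm) auto
      then show "x [^] (p ^ n) \<otimes> inv x [^] (p ^ n) = \<one>"
        using xU by simp
    qed (use xU in auto)
    moreover have "inv (x [^] (p ^ n)) \<in> L"
      using subfield_m_inv(1)[OF L] x nz by (auto simp: root_field_def)
    moreover have "inv x \<in> E"
      using subfield_m_inv(1)[OF E] x by (auto simp: root_field_def)
    ultimately show "inv x \<in> root_field R L n E"
      by (simp add: root_field_def)
  qed
qed

text \<open>
  The elements whose \<open>p\<close>-th power lies in the right-hand field form a field, and this field
  contains \<open>H\<close>.
\<close>
lemma power_in_generate_field:
  assumes H: "H \<subseteq> carrier R" and x: "x \<in> generate_field R H"
  shows "x [^] p \<in> generate_field R ((\<lambda>h. h [^] p) ` H)"
proof -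
  let ?G = "generate_field R ((\<lambda>h. h [^] p) ` H)"
  have "subfield ?G R"
    using H by (intro generate_field_is_subfield) auto
  then have "subfield (root_field R ?G 1 (carrier R)) R"
    by (intro root_field_is_subfield carrier_is_subfield)
  moreover have "H \<subseteq> root_field R ?G 1 (carrier R)"
    using H by (auto simp: root_field_def intro: generate_field.incl)
  ultimately have "generate_field R H \<subseteq> root_field R ?G 1 (carrier R)"
    by (intro generate_field_min_subfield1 H)
  then show ?thesis
    using x by (auto simp: root_field_def)
qed

section \<open>Adjoining \<open>p\<close>-th powers, and the descending chain of its iterates\<close>

lemma adjoin_pth_powers_least:
  assumes "subfield F R" "k \<subseteq> F" "\<And>x. x \<in> M \<Longrightarrow> x [^] p \<in> F"
  shows "adjoin_pth_powers R k M \<subseteq> F"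
proof -
  have sub: "k \<union> (\<lambda>x. x [^] p) ` M \<subseteq> F"
    using assms(2,3) by blast
  show ?thesis
    unfolding adjoin_pth_powers_def
    using sub subfieldE(3)[OF assms(1)] by (intro generate_field_min_subfield1[OF _ assms(1)]) auto
qed

lemma adjoin_pth_powers_upper:
  "k \<subseteq> adjoin_pth_powers R k M" "x \<in> M \<Longrightarrow> x [^] p \<in> adjoin_pth_powers R k M"
  unfolding adjoin_pth_powers_def by (blast intro: generate_field.incl)+

lemma adjoin_pth_powers_is_subfield:
  assumes "k \<subseteq> carrier R" "M \<subseteq> carrier R"
  shows "subfield (adjoin_pth_powers R k M) R"
  unfolding adjoin_pth_powers_def using assms by (intro generate_field_is_subfield) auto

lemma adjoin_pth_powers_mono:
  assumes "k \<subseteq> carrier R" "M \<subseteq> N" "N \<subseteq> carrier R"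
  shows "adjoin_pth_powers R k M \<subseteq> adjoin_pth_powers R k N"
  using assms adjoin_pth_powers_upper(1)[of k N] adjoin_pth_powers_upper(2)[of _ N k]
  by (intro adjoin_pth_powers_least adjoin_pth_powers_is_subfield) auto

lemma adjoin_pth_powers_intermediate:
  assumes "intermediate_field R k E M"
  shows "intermediate_field R k M (adjoin_pth_powers R k M)"
proof -
  have M: "subfield M R" "k \<subseteq> M"
    using assms by (auto simp: intermediate_field_def)
  then have c: "k \<subseteq> carrier R" "M \<subseteq> carrier R"
    using subfieldE(3) by blast+
  have "adjoin_pth_powers R k M \<subseteq> M"
    using M subfield_nat_pow_closed by (intro adjoin_pth_powers_least) auto
  then show ?thesis
    using adjoin_pth_powers_is_subfield[OF c] adjoin_pth_powers_upper(1)
    by (auto simp: intermediate_field_def)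
qed

text \<open>
  With \<open>P M = k(M\<^sup>p)\<close>: the Frobenius map sends \<open>M = (P M)(A)\<close> into the field generated by
  \<open>(P M)\<^sup>p\<close> and \<open>A\<^sup>p\<close>, and \<open>(P M)\<^sup>p\<close> lies in \<open>P (P M)\<close>. So a generating set of one step of the chain gives,
  after raising to \<open>p\<close>-th powers, a generating set of the next step.
\<close>
lemma adjoin_pth_powers_generators:
  assumes M: "intermediate_field R k E M"
    and A: "generate_field R (adjoin_pth_powers R k M \<union> A) = M"
  shows "generate_field R (adjoin_pth_powers R k (adjoin_pth_powers R k M) \<union> (\<lambda>a. a [^] p) ` A)
    = adjoin_pth_powers R k M"
proof -
  let ?P = "adjoin_pth_powers R k"
  let ?G = "generate_field R (?P (?P M) \<union> (\<lambda>a. a [^] p) ` A)"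
  have PM: "intermediate_field R k M (?P M)" and PPM: "intermediate_field R k (?P M) (?P (?P M))"
    using adjoin_pth_powers_intermediate M by blast+
  have sub: "subfield (?P M) R"
    using PM by (simp add: intermediate_field_def)
  have AM: "?P M \<union> A \<subseteq> M"
    using A by (blast intro: generate_field.incl)
  have Mc: "M \<subseteq> carrier R"
    using M subfieldE(3) by (auto simp: intermediate_field_def)
  have GP: "?P (?P M) \<union> (\<lambda>a. a [^] p) ` A \<subseteq> ?P M"
    using PPM AM adjoin_pth_powers_upper(2) by (auto simp: intermediate_field_def)
  have Pc: "?P M \<subseteq> carrier R"
    using subfieldE(3)[OF sub] .
  have c: "?P (?P M) \<union> (\<lambda>a. a [^] p) ` A \<subseteq> carrier R"
    using GP Pc by blast
  have G: "subfield ?G R"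
    by (rule generate_field_is_subfield[OF c])
  have "?G \<subseteq> ?P M"
    by (rule generate_field_min_subfield1[OF c sub GP])
  moreover have "?P M \<subseteq> ?G"
  proof (rule adjoin_pth_powers_least[OF G])
    show "k \<subseteq> ?G"
      using adjoin_pth_powers_upper(1) by (blast intro: generate_field.incl)
  next
    fix x assume "x \<in> M"
    then have "x [^] p \<in> generate_field R ((\<lambda>h. h [^] p) ` (?P M \<union> A))"
      using A AM Mc by (intro power_in_generate_field) auto
    moreover have le: "(\<lambda>h. h [^] p) ` (?P M \<union> A) \<subseteq> ?P (?P M) \<union> (\<lambda>a. a [^] p) ` A"
      using adjoin_pth_powers_upper(2)[of _ "?P M" k] by auto
    ultimately show "x [^] p \<in> ?G"
      using mono_generate_field[OF le c] by blast
  qed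
  ultimately show ?thesis by blast
qed

lemma iterated_adjoin_pth_powers_intermediate:
  assumes "intermediate_field R k E M"
  shows "intermediate_field R k M ((adjoin_pth_powers R k ^^ n) M)"
proof (induction n)
  case 0
  then show ?case using assms by (simp add: intermediate_field_def)
next
  case (Suc n)
  then show ?case
    using adjoin_pth_powers_intermediate[OF Suc] by (auto simp: intermediate_field_def)
qed

lemma iterated_adjoin_pth_powers_generators:
  assumes M: "intermediate_field R k E M"
    and A: "generate_field R (adjoin_pth_powers R k M \<union> A) = M"
  shows "generate_field R ((adjoin_pth_powers R k ^^ Suc n) M \<union> (\<lambda>a. a [^] (p ^ n)) ` A)
    = (adjoin_pth_powers R k ^^ n) M"
proof (induction n)
  case 0
  have "A \<subseteq> M"
    using A by (blast intro: generate_field.incl)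
  then have "A \<subseteq> carrier R"
    using M subfieldE(3) by (auto simp: intermediate_field_def)
  then have "(\<lambda>a. a [^] (p ^ 0)) ` A = A"
    by (force simp: image_iff)
  then show ?case using A by simp
next
  case (Suc n)
  have "A \<subseteq> M"
    using A by (blast intro: generate_field.incl)
  then have "A \<subseteq> carrier R"
    using M subfieldE(3) by (auto simp: intermediate_field_def)
  then have "(\<lambda>a. a [^] p) ` (\<lambda>a. a [^] (p ^ n)) ` A = (\<lambda>a. a [^] (p ^ Suc n)) ` A"
    unfolding image_image by (intro image_cong) (auto simp: nat_pow_pow mult.commute)
  moreover have "generate_field R (adjoin_pth_powers R k ((adjoin_pth_powers R k ^^ n) M)
      \<union> (\<lambda>a. a [^] (p ^ n)) ` A) = (adjoin_pth_powers R k ^^ n) M"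
    using Suc by simp
  note adjoin_pth_powers_generators[OF iterated_adjoin_pth_powers_intermediate[OF M] this]
  ultimately show ?case
    by (simp only: funpow.simps o_apply)
qed

text \<open>
  Over a finite set, the exponents that pure inseparability gives for the single elements can be
  replaced by a common larger one, because \<open>k\<close> is closed under powers.
\<close>
lemma pth_power_exponent_uniform:
  assumes k: "subfield k R" and pi: "purely_inseparable R k (carrier R)"
    and "finite A" "A \<subseteq> carrier R"
  obtains n where "(\<lambda>a. a [^] (p ^ n)) ` A \<subseteq> k"
proof -
  have "\<exists>n. (\<lambda>a. a [^] (p ^ n)) ` A \<subseteq> k"
    using assms(3,4)
  proof (induction A)
    case (insert a A)
    obtain m where m: "(\<lambda>a. a [^] (p ^ m)) ` A \<subseteq> k"
      using insert by auto
    obtain n where n: "a [^] (p ^ n) \<in> k"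
      using pi insert.prems by (auto simp: purely_inseparable_def)
    have up: "x [^] (p ^ (i + j)) \<in> k" if "x [^] (p ^ i) \<in> k" "x \<in> carrier R" for x i j
    proof -
      have "x [^] (p ^ (i + j)) = (x [^] (p ^ i)) [^] (p ^ j)"
        using that by (simp add: nat_pow_pow power_add)
      then show ?thesis
        using subfield_nat_pow_closed[OF k that(1)] by simp
    qed
    have "(\<lambda>a. a [^] (p ^ (m + n))) ` insert a A \<subseteq> k"
      using up[of _ m n] up[OF n, of m] m insert.prems by (auto simp: add.commute)
    then show ?case ..
  qed auto
  then show thesis using that by blast
qed

text \<open>
  The chain of iterates becomes stationary as soon as the generators of a step,
  which are the \<open>p\<^sup>n\<close>-th powers of finitely many elements, all lie in \<open>k\<close>.
\<close>
lemma iterated_adjoin_pth_powers_relatively_perfect: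
  assumes k: "subfield k R" and pi: "purely_inseparable R k (carrier R)"
    and M: "intermediate_field R k E M"
    and fin: "finite_dimension (adjoin_pth_powers R k M) M"
  obtains n where "relatively_perfect R k ((adjoin_pth_powers R k ^^ n) M)"
proof -
  let ?P = "adjoin_pth_powers R k"
  have sub: "subfield M R" and PM: "subfield (?P M) R" "?P M \<subseteq> M"
    using M adjoin_pth_powers_intermediate[OF M] by (auto simp: intermediate_field_def)
  obtain A where A: "finite A" "A \<subseteq> M" "generate_field R (?P M \<union> A) = M"
    using finite_dimension_imp_finitely_generated[OF PM(1) sub PM(2) fin] .
  obtain n where n: "(\<lambda>a. a [^] (p ^ n)) ` A \<subseteq> k"
    using pth_power_exponent_uniform[OF k pi A(1)] A(2) subfieldE(3)[OF sub] by blast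
  have S: "intermediate_field R k M ((?P ^^ Suc n) M)"
    by (rule iterated_adjoin_pth_powers_intermediate[OF M])
  then have sS: "subfield ((?P ^^ Suc n) M) R" "k \<subseteq> (?P ^^ Suc n) M"
    by (simp_all add: intermediate_field_def)
  have "(?P ^^ n) M = generate_field R ((?P ^^ Suc n) M \<union> (\<lambda>a. a [^] (p ^ n)) ` A)"
    using iterated_adjoin_pth_powers_generators[OF M A(3)] by simp
  also have "\<dots> = generate_field R ((?P ^^ Suc n) M)"
    using n sS(2) by (simp add: Un_absorb2 del: funpow.simps)
  also have "\<dots> = (?P ^^ Suc n) M"
    using generate_field_min_subfield1[OF subfieldE(3)[OF sS(1)] sS(1)]
    by (blast intro: generate_field.incl)
  finally show thesis
    using that[of n] by (simp add: relatively_perfect_def)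
qed

lemma finite_over_iterated_adjoin_pth_powers:
  assumes fin: "\<And>M. intermediate_field R k E M \<Longrightarrow> finite_dimension (adjoin_pth_powers R k M) M"
    and M: "intermediate_field R k E M"
  shows "finite_dimension ((adjoin_pth_powers R k ^^ n) M) M"
proof (induction n)
  case 0
  have "subfield M R" using M by (simp add: intermediate_field_def)
  then show ?case using finite_dimensionI[OF dimension_one] by simp
next
  case (Suc n)
  let ?N = "(adjoin_pth_powers R k ^^ n) M"
  have N: "intermediate_field R k M ?N"
    by (rule iterated_adjoin_pth_powers_intermediate[OF M])
  then have NE: "intermediate_field R k E ?N"
    using M by (auto simp: intermediate_field_def)
  have "subfield ?N R" "subfield (adjoin_pth_powers R k ?N) R"
    using N adjoin_pth_powers_intermediate[OF N] by (simp_all add: intermediate_field_def)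
  then show ?case
    using telescopic_base_dim(1)[OF _ _ fin[OF NE] Suc] by simp
qed

section \<open>The implications between the finiteness conditions\<close>

text \<open>
  The tower of root fields of \<open>L\<close> is climbed one step at a time: the \<open>p\<close>-th powers of one floor,
  and hence all of the field that they generate over \<open>k\<close>, lie in the floor below.
\<close>
lemma finite_over_adjoin_pth_powers_imp_lq_finite:
  assumes E: "subfield E R"
    and fin: "\<And>M. intermediate_field R k E M \<Longrightarrow> finite_dimension (adjoin_pth_powers R k M) M"
    and L: "intermediate_field R k E L"
  shows "lq_finite R L E"
proof -
  have sL: "subfield L R" "k \<subseteq> L" "L \<subseteq> E"
    using L by (auto simp: intermediate_field_def)
  let ?M = "\<lambda>n. root_field R L n E"
  have sub: "subfield (?M n) R" for n
    by (rule root_field_is_subfield[OF sL(1) E])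
  have LM: "L \<subseteq> ?M n" for n
    using sL(3) subfield_nat_pow_closed[OF sL(1)] by (auto simp: root_field_def)
  have Ec: "x \<in> carrier R" if "x \<in> E" for x
    using subfieldE(3)[OF E] that by blast
  have "finite_dimension L (?M n)" for n
  proof (induction n)
    case 0
    have "?M 0 = L"
      using sL(3) by (auto simp: root_field_def Ec subsetD)
    then show ?case using finite_dimensionI[OF dimension_one[OF sL(1)]] by simp
  next
    case (Suc n)
    have M: "intermediate_field R k E (?M (Suc n))"
      using sub[of "Suc n"] LM[of "Suc n"] sL(2)
      unfolding intermediate_field_def by (auto simp: root_field_def)
    have PM: "intermediate_field R k (?M (Suc n)) (adjoin_pth_powers R k (?M (Suc n)))"
      by (rule adjoin_pth_powers_intermediate[OF M])
    have pow: "x [^] p \<in> ?M n" if "x \<in> ?M (Suc n)" for x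
      using that subfield_nat_pow_closed[OF E] by (auto simp: root_field_def nat_pow_pow Ec)
    have "adjoin_pth_powers R k (?M (Suc n)) \<subseteq> ?M n"
      using sL(2) LM[of n] pow by (intro adjoin_pth_powers_least sub) auto
    moreover have "?M n \<subseteq> ?M (Suc n)"
    proof
      fix x assume x: "x \<in> ?M n"
      then have "x [^] (p ^ Suc n) = (x [^] (p ^ n)) [^] p"
        by (simp add: root_field_def nat_pow_pow Ec mult.commute)
      then show "x \<in> ?M (Suc n)"
        using x subfield_nat_pow_closed[OF sL(1)] by (simp add: root_field_def)
    qed
    ultimately have "finite_dimension (?M n) (?M (Suc n))"
      using PM finite_dimension_of_intermediate_field(1)[OF _ sub sub _ _ fin[OF M]]
      by (auto simp: intermediate_field_def)
    then show ?case
      by (rule telescopic_base_dim(1)[OF sL(1) sub Suc])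
  qed
  then show ?thesis by (simp add: lq_finite_def)
qed

text \<open>
  The hypothesis is applied not to \<open>L\<close> but to the smaller field \<open>k(L\<^sup>p)\<close>, whose first root field
  contains \<open>L\<close>.
\<close>
lemma lq_finite_imp_finite_over_adjoin_pth_powers:
  assumes E: "subfield E R"
    and lq: "\<And>L. intermediate_field R k E L \<Longrightarrow> lq_finite R L E"
    and L: "intermediate_field R k E L"
  shows "finite_dimension (adjoin_pth_powers R k L) L"
proof -
  let ?P = "adjoin_pth_powers R k L"
  have P: "intermediate_field R k L ?P"
    by (rule adjoin_pth_powers_intermediate[OF L])
  then have sub: "subfield ?P R" "subfield L R" "?P \<subseteq> L" and PE: "intermediate_field R k E ?P"
    using L by (auto simp: intermediate_field_def)
  have "finite_dimension ?P (root_field R ?P 1 E)"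
    using lq[OF PE] by (auto simp: lq_finite_def)
  moreover have "L \<subseteq> root_field R ?P 1 E"
    using L adjoin_pth_powers_upper(2) by (auto simp: root_field_def intermediate_field_def)
  ultimately show ?thesis
    using finite_dimension_of_intermediate_field(2)[OF sub(1,2)] sub root_field_is_subfield[OF _ E]
    by blast
qed

text \<open>
  The stationary value of the chain of iterates is relatively perfect, so it lies below \<open>rp(L/k)\<close>;
  and \<open>L\<close> is finite over it, since the chain reaches it in finitely many finite steps.
\<close>
lemma finite_over_adjoin_pth_powers_imp_finite_over_rp:
  assumes k: "subfield k R" and pi: "purely_inseparable R k (carrier R)"
    and fin: "\<And>M. intermediate_field R k E M \<Longrightarrow> finite_dimension (adjoin_pth_powers R k M) M"
    and L: "intermediate_field R k E L"
  shows "finite_dimension (rp R k L) L"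
proof -
  have sL: "subfield L R" "k \<subseteq> L"
    using L by (auto simp: intermediate_field_def)
  note rp = rp_greatest[OF field_axioms k sL]
  obtain n where n: "relatively_perfect R k ((adjoin_pth_powers R k ^^ n) L)"
    using iterated_adjoin_pth_powers_relatively_perfect[OF k pi L fin[OF L]] .
  let ?N = "(adjoin_pth_powers R k ^^ n) L"
  have N: "intermediate_field R k L ?N"
    by (rule iterated_adjoin_pth_powers_intermediate[OF L])
  show ?thesis
    using finite_dimension_of_intermediate_field(1)
        [OF _ _ sL(1) rp(3)[OF N n] _ finite_over_iterated_adjoin_pth_powers[OF fin L]]
      N rp(1) by (simp add: intermediate_field_def)
qed

text \<open>
  Relative perfectness places \<open>rp(L/k)\<close> inside \<open>k(L\<^sup>p)\<close>.
\<close>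
lemma finite_over_rp_imp_finite_over_adjoin_pth_powers:
  assumes k: "subfield k R" and L: "intermediate_field R k E L"
    and fin: "finite_dimension (rp R k L) L"
  shows "finite_dimension (adjoin_pth_powers R k L) L"
proof -
  have sL: "subfield L R" "k \<subseteq> L"
    using L by (auto simp: intermediate_field_def)
  note rp = rp_greatest[OF field_axioms k sL]
  have r: "subfield (rp R k L) R" "rp R k L \<subseteq> L"
    using rp(1) by (auto simp: intermediate_field_def)
  have P: "intermediate_field R k L (adjoin_pth_powers R k L)"
    by (rule adjoin_pth_powers_intermediate[OF L])
  have "rp R k L = adjoin_pth_powers R k (rp R k L)"
    using rp(2) by (simp add: relatively_perfect_def)
  also have "\<dots> \<subseteq> adjoin_pth_powers R k L"
    by (rule adjoin_pth_powers_mono[OF subfieldE(3)[OF k] r(2) subfieldE(3)[OF sL(1)]])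
  finally show ?thesis
    using finite_dimension_of_intermediate_field(1)[OF r(1) _ sL(1) _ _ fin] P
    by (simp add: intermediate_field_def)
qed

end

theorem proposition9p1:
  fixes K :: "('a, 'b) ring_scheme" and k :: "'a set"
  assumes "field K"
    and "characteristic K > 0"
    and "subfield k K"
    and "purely_inseparable K k (carrier K)"
  shows "((\<forall>L. intermediate_field K k (carrier K) L \<longrightarrow> lq_finite K L (carrier K))
          \<longleftrightarrow> (\<forall>L. intermediate_field K k (carrier K) L \<longrightarrow>
                ring.finite_dimension K (adjoin_pth_powers K k L) L))
       \<and> ((\<forall>L. intermediate_field K k (carrier K) L \<longrightarrow>
                ring.finite_dimension K (adjoin_pth_powers K k L) L)
          \<longleftrightarrow> (\<forall>L. intermediate_field K k (carrier K) L \<longrightarrow>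
                ring.finite_dimension K (rp K k L) L))"
proof -
  interpret field K by fact
  interpret positive_characteristic_field K
    by unfold_locales fact
  note E = carrier_is_subfield
  show ?thesis
    using lq_finite_imp_finite_over_adjoin_pth_powers[OF E]
      finite_over_adjoin_pth_powers_imp_lq_finite[OF E]
      finite_over_adjoin_pth_powers_imp_finite_over_rp[OF assms(3,4)]
      finite_over_rp_imp_finite_over_adjoin_pth_powers[OF assms(3)]
    by blast
qed

end
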